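(* The simple degree sequence region $\mathbb D[\varphi^*_{JMS}]$ is fully graphic, where $\varphi^*_{JMS}(n,\Sigma,c_1,c_2)$ is the inequality $$(\Sigma-nc_2)(nc_1-\Sigma)\le (c_1-c_2)\big\{(\Sigma-nc_2)(n-c_1-1)+(nc_1-\Sigma)c_2\big\}.$$
   Context: For natural numbers $n>c_1\ge c_2$ and $\Sigma$, $\mathcal D(n,\Sigma,c_1,c_2)$ is the set of integer sequences $(d_1,\dots,d_n)$ with $c_1\ge d_1\ge\dots\ge d_n\ge c_2$, $\sum_i d_i$ even and $\sum_i d_i=\Sigma$. For a property $\varphi$, $\mathbb D[\varphi]$ is the union of all $\mathcal D(n,\Sigma,c_1,c_2)$ with $n>c_1\ge c_2$ and $\varphi(n,\Sigma,c_1,c_2)$ true. A region is fully graphic if every sequence in it is graphic (the degree sequence of a simple graph on labelled vertices). *)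

theory Defs
  imports Main
begin

definition simple_graph :: "'a set \<Rightarrow> 'a set set \<Rightarrow> bool" where
  "simple_graph V E \<longleftrightarrow> finite V \<and> (\<forall>e\<in>E. e \<subseteq> V \<and> card e = 2)"

definition degree :: "'a set set \<Rightarrow> 'a \<Rightarrow> nat" where
  "degree E v = card {e \<in> E. v \<in> e}"

(* A sequence (d_1, ..., d_n) is a list of length n; its i-th entry (counted from 0)
   is the prescribed degree of the vertex labelled i. *)
definition graphic :: "int list \<Rightarrow> bool" where
  "graphic d \<longleftrightarrow>
     (\<exists>E. simple_graph {..<length d} E \<and> (\<forall>i<length d. int (degree E i) = d ! i))"

(* The sorted_wrt clause is the chain c_1 \<ge> d_1 \<ge> ... \<ge> d_n \<ge> c_2. *)
definition degree_seqs :: "nat \<Rightarrow> nat \<Rightarrow> nat \<Rightarrow> nat \<Rightarrow> int list set" where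
  "degree_seqs n \<Sigma> c\<^sub>1 c\<^sub>2 =
     {d. length d = n \<and> sorted_wrt (\<ge>) (int c\<^sub>1 # d @ [int c\<^sub>2]) \<and>
         even (sum_list d) \<and> sum_list d = int \<Sigma>}"

definition region :: "(nat \<Rightarrow> nat \<Rightarrow> nat \<Rightarrow> nat \<Rightarrow> bool) \<Rightarrow> int list set" where
  "region \<phi> =
     \<Union> {degree_seqs n \<Sigma> c\<^sub>1 c\<^sub>2 | n \<Sigma> c\<^sub>1 c\<^sub>2. n > c\<^sub>1 \<and> c\<^sub>1 \<ge> c\<^sub>2 \<and> \<phi> n \<Sigma> c\<^sub>1 c\<^sub>2}"

definition fully_graphic :: "int list set \<Rightarrow> bool" where
  "fully_graphic R \<longleftrightarrow> (\<forall>d\<in>R. graphic d)"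

(* The differences are taken in int: \<phi> is also evaluated at arguments where, for instance,
   \<Sigma> < n * c_2, and subtraction on nat would truncate. *)
definition \<phi>_JMS :: "nat \<Rightarrow> nat \<Rightarrow> nat \<Rightarrow> nat \<Rightarrow> bool" where
  "\<phi>_JMS n \<Sigma> c\<^sub>1 c\<^sub>2 \<longleftrightarrow>
     (int \<Sigma> - int n * int c\<^sub>2) * (int n * int c\<^sub>1 - int \<Sigma>)
       \<le> (int c\<^sub>1 - int c\<^sub>2) *
           ((int \<Sigma> - int n * int c\<^sub>2) * (int n - int c\<^sub>1 - 1)
             + (int n * int c\<^sub>1 - int \<Sigma>) * int c\<^sub>2)"

end

theory Submission
  imports Defs
begin

text \<open>
  The proof goes through the Erdos-Gallai criterion. Its sufficiency is shown by the
  constructive argument of Tripathi, Venugopalan and West: the vertices are saturated one after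
  the other in the order of decreasing prescribed degree, and when no local exchange increases
  the degree of the current vertex \<open>r\<close>, the first vertices form a clique and the Erdos-Gallai
  inequality at \<open>r\<close> fails.

  To derive the criterion at \<open>k\<close> from the hypothesis, put \<open>X = \<Sigma> - n c\<^sub>2\<close> and \<open>D = c\<^sub>1 - c\<^sub>2\<close>.
  The extremal sequence has about \<open>X / D\<close> entries \<open>c\<^sub>1\<close> followed by entries \<open>c\<^sub>2\<close>. The
  hypothesis is the inequality at \<open>k = X / D\<close> for that sequence; concavity of \<open>min _ k\<close> and the
  bound \<open>k c\<^sub>1\<close> on the first \<open>k\<close> entries reduce the case \<open>k \<le> X / D\<close> to it, and the bound
  \<open>X + k c\<^sub>2\<close> reduces the case \<open>k > X / D\<close> to it.
\<close>

section \<open>Degrees under exchange of edges\<close>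

lemma simple_graph_finite:
  assumes "simple_graph V E"
  shows "finite E"
proof -
  have "E \<subseteq> Pow V" "finite V" using assms by (auto simp: simple_graph_def)
  then show ?thesis by (meson finite_Pow_iff finite_subset)
qed

lemma simple_graph_edgeD:
  assumes "simple_graph V E" "{u, v} \<in> E"
  shows "u \<in> V" "v \<in> V" "u \<noteq> v"
  using assms by (auto simp: simple_graph_def card_2_iff' dest!: bspec)

lemma degree_empty [simp]: "degree {} w = 0"
  by (simp add: degree_def)

lemma degree_insert:
  assumes "finite E" "e \<notin> E"
  shows "degree (insert e E) w = degree E w + (if w \<in> e then 1 else 0)"
proof -
  have "{x \<in> insert e E. w \<in> x} = (if w \<in> e then insert e {x \<in> E. w \<in> x} else {x \<in> E. w \<in> x})"
    by auto
  then show ?thesis using assms by (simp add: degree_def)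
qed

lemma degree_Un_disjoint:
  assumes "finite A" "finite B" "A \<inter> B = {}"
  shows "degree (A \<union> B) w = degree A w + degree B w"
proof -
  have "{e \<in> A \<union> B. w \<in> e} = {e \<in> A. w \<in> e} \<union> {e \<in> B. w \<in> e}" by auto
  moreover have "card ({e \<in> A. w \<in> e} \<union> {e \<in> B. w \<in> e}) = card {e \<in> A. w \<in> e} + card {e \<in> B. w \<in> e}"
    using assms by (intro card_Un_disjoint) auto
  ultimately show ?thesis by (simp only: degree_def)
qed

text \<open>The deleted part is added on the left, which avoids truncated subtraction on
  \<open>nat\<close>.\<close>

lemma degree_exchange:
  assumes "finite E" "finite I" "D \<subseteq> E" "I \<inter> E = {}"
  shows "degree (E - D \<union> I) w + degree D w = degree E w + degree I w"
proof -
  have D: "finite D" using assms finite_subset by blast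
  have "degree E w = degree (E - D) w + degree D w"
    using degree_Un_disjoint[of "E - D" D w] assms(1,3) D by (simp add: Un_absorb2 Int_commute)
  moreover have "degree (E - D \<union> I) w = degree (E - D) w + degree I w"
    using assms by (intro degree_Un_disjoint) auto
  ultimately show ?thesis by simp
qed

lemma degree_eq_card_neighbours:
  assumes "simple_graph V E"
  shows "degree E v = card {u \<in> V. {u, v} \<in> E}"
proof -
  have "bij_betw (\<lambda>u. {u, v}) {u \<in> V. {u, v} \<in> E} {e \<in> E. v \<in> e}"
  proof (rule bij_betw_imageI)
    show "inj_on (\<lambda>u. {u, v}) {u \<in> V. {u, v} \<in> E}"
      by (auto simp: inj_on_def doubleton_eq_iff)
    show "(\<lambda>u. {u, v}) ` {u \<in> V. {u, v} \<in> E} = {e \<in> E. v \<in> e}"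
    proof (intro equalityI subsetI)
      fix e assume e: "e \<in> {e \<in> E. v \<in> e}"
      then have "card e = 2" "e \<subseteq> V" using assms by (auto simp: simple_graph_def)
      then obtain u where "e = {u, v}" "u \<in> V"
        using e by (auto simp: card_2_iff insert_commute)
      then show "e \<in> (\<lambda>u. {u, v}) ` {u \<in> V. {u, v} \<in> E}" using e by auto
    qed auto
  qed
  then show ?thesis by (simp add: degree_def bij_betw_same_card)
qed

lemma handshake:
  assumes "simple_graph V E"
  shows "(\<Sum>v\<in>V. degree E v) = 2 * card E"
proof -
  have fin: "finite E" "finite V"
    using assms simple_graph_finite by (auto simp: simple_graph_def)
  have "(\<Sum>v\<in>V. degree E v) = (\<Sum>v\<in>V. \<Sum>e\<in>E. if v \<in> e then 1 else 0)"
    using fin by (simp add: degree_def sum.If_cases Int_def)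
  also have "\<dots> = (\<Sum>e\<in>E. \<Sum>v\<in>V. if v \<in> e then 1 else 0)" by (rule sum.swap)
  also have "\<dots> = (\<Sum>e\<in>E. 2)"
  proof (rule sum.cong)
    fix e assume "e \<in> E"
    then have "card e = 2" "V \<inter> e = e" using assms by (auto simp: simple_graph_def)
    then show "(\<Sum>v\<in>V. if v \<in> e then 1 else 0) = (2::nat)" using fin by (simp add: sum.If_cases)
  qed simp
  finally show ?thesis by simp
qed

text \<open>Otherwise all neighbours of \<open>a\<close> except \<open>b\<close> would be neighbours
  of \<open>b\<close>, giving \<open>b\<close> at least the degree of \<open>a\<close>. Replacing
  \<open>{u, a}\<close> by \<open>{u, b}\<close> then moves one unit of degree from \<open>a\<close>
  to \<open>b\<close>.\<close>

lemma private_neighbour: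
  assumes "simple_graph V E" "degree E b < degree E a"
  obtains u where "u \<in> V" "u \<noteq> a" "u \<noteq> b" "{u, a} \<in> E" "{u, b} \<notin> E"
proof -
  let ?N = "\<lambda>v. {u \<in> V. {u, v} \<in> E}"
  have fin: "finite (?N v)" for v using assms by (auto simp: simple_graph_def)
  have "\<exists>u\<in>?N a. u \<noteq> b \<and> {u, b} \<notin> E"
  proof (rule ccontr)
    assume "\<not> ?thesis"
    then have sub: "?N a - {b} \<subseteq> ?N b - {a}"
      using simple_graph_edgeD(3)[OF assms(1)] by blast
    have ab: "b \<in> ?N a \<longleftrightarrow> a \<in> ?N b"
      using simple_graph_edgeD[OF assms(1)] by (auto simp: insert_commute)
    have le: "card (?N a - {b}) \<le> card (?N b - {a})" using sub fin by (intro card_mono) auto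
    have "card (?N a) \<le> card (?N b)"
    proof (cases "b \<in> ?N a")
      case True
      then have "card (?N a) = Suc (card (?N a - {b}))" "card (?N b) = Suc (card (?N b - {a}))"
        using card_Suc_Diff1[OF fin, of b a] card_Suc_Diff1[OF fin, of a b] ab by auto
      then show ?thesis using le by simp
    next
      case False
      then have "?N a - {b} = ?N a" "?N b - {a} = ?N b" using ab by blast+
      then show ?thesis using le by (simp only:)
    qed
    then show False using assms by (simp add: degree_eq_card_neighbours)
  qed
  then show ?thesis using that simple_graph_edgeD(3)[OF assms(1)] by blast
qed

section \<open>Sufficiency of the Erdos-Gallai criterion\<close>

text \<open>The vertices beyond \<open>r\<close> are kept independent, so that their degrees count
  only edges to \<open>{..r}\<close>.\<close>

definition partial_realization :: "nat \<Rightarrow> (nat \<Rightarrow> nat) \<Rightarrow> nat \<Rightarrow> nat set set \<Rightarrow> bool" where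
  "partial_realization n f r E \<longleftrightarrow>
     simple_graph {..<n} E \<and> (\<forall>e\<in>E. \<exists>x\<in>e. x \<le> r) \<and>
     (\<forall>v<n. degree E v \<le> f v) \<and> (\<forall>v<r. degree E v = f v)"

lemma partial_realization_exchange:
  assumes E: "partial_realization n f r E"
    and fin: "finite I" and D: "D \<subseteq> E" and I: "I \<inter> E = {}"
    and edges: "\<forall>e\<in>I. e \<subseteq> {..<n} \<and> card e = 2 \<and> (\<exists>x\<in>e. x \<le> r)"
    and le: "\<forall>v<n. degree E v + degree I v \<le> f v + degree D v"
    and eq: "\<forall>v<r. degree I v = degree D v"
  shows "partial_realization n f r (E - D \<union> I)"
proof -
  have sg: "simple_graph {..<n} E" using E by (simp add: partial_realization_def)
  have deg: "degree (E - D \<union> I) v + degree D v = degree E v + degree I v" for v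
    using simple_graph_finite[OF sg] fin D I by (rule degree_exchange)
  have "degree (E - D \<union> I) v \<le> f v" if "v < n" for v using deg[of v] le that by force
  moreover have "degree (E - D \<union> I) v = f v" if "v < r" for v
    using deg[of v] eq E that by (simp add: partial_realization_def)
  ultimately show ?thesis
    using E edges by (auto simp: partial_realization_def simple_graph_def)
qed

text \<open>Double counting of the edges leaving the clique: by \<open>cover\<close>, outer vertices
  have neighbours only inside it.\<close>

lemma clique_degree_sum:
  assumes sg: "simple_graph {..<n} E" and r: "r < n"
    and cover: "\<forall>e\<in>E. \<exists>x\<in>e. x \<le> r"
    and clique: "\<And>i j. i < j \<Longrightarrow> j \<le> r \<Longrightarrow> {i, j} \<in> E"
  shows "(\<Sum>i\<le>r. degree E i) = Suc r * r + (\<Sum>k\<in>{Suc r..<n}. degree E k)"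
proof -
  let ?S = "{Suc r..<n}"
  let ?a = "\<lambda>i k. if {k, i} \<in> E then 1 else (0::nat)"
  have inner: "degree E i = r + (\<Sum>k\<in>?S. ?a i k)" if "i \<le> r" for i
  proof -
    have adj: "{u, i} \<in> E" if "u \<le> r" "u \<noteq> i" for u
    proof (cases "u < i")
      case True
      then show ?thesis using clique \<open>i \<le> r\<close> by blast
    next
      case False
      then have "{i, u} \<in> E" using clique that by (simp add: less_le)
      then show ?thesis by (simp only: insert_commute)
    qed
    have "{u \<in> {..<n}. {u, i} \<in> E} = ({..r} - {i}) \<union> {k \<in> ?S. {k, i} \<in> E}"
    proof (intro equalityI subsetI)
      fix u assume "u \<in> {u \<in> {..<n}. {u, i} \<in> E}"
      then show "u \<in> ({..r} - {i}) \<union> {k \<in> ?S. {k, i} \<in> E}"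
        using simple_graph_edgeD(3)[OF sg, of u i] by (cases "u \<le> r") auto
    next
      fix u assume "u \<in> ({..r} - {i}) \<union> {k \<in> ?S. {k, i} \<in> E}"
      then show "u \<in> {u \<in> {..<n}. {u, i} \<in> E}" using adj[of u] r by auto
    qed
    then have "degree E i = card (({..r} - {i}) \<union> {k \<in> ?S. {k, i} \<in> E})"
      by (simp add: degree_eq_card_neighbours[OF sg])
    also have "\<dots> = card ({..r} - {i}) + card {k \<in> ?S. {k, i} \<in> E}"
      by (rule card_Un_disjoint) auto
    finally show ?thesis using that by (simp add: sum.If_cases Int_def)
  qed
  have outer: "degree E k = (\<Sum>i\<le>r. ?a i k)" if "k \<in> ?S" for k
  proof -
    have "u \<le> r" if "{u, k} \<in> E" for u using cover that \<open>k \<in> ?S\<close> by force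
    then have "{u \<in> {..<n}. {u, k} \<in> E} = {u \<in> {..r}. {k, u} \<in> E}"
      using r by (auto simp: insert_commute[of k] intro: le_less_trans)
    then show ?thesis by (simp add: degree_eq_card_neighbours[OF sg] sum.If_cases Int_def)
  qed
  have "(\<Sum>i\<le>r. degree E i) = Suc r * r + (\<Sum>i\<le>r. \<Sum>k\<in>?S. ?a i k)"
    by (simp add: inner sum.distrib)
  also have "(\<Sum>i\<le>r. \<Sum>k\<in>?S. ?a i k) = (\<Sum>k\<in>?S. \<Sum>i\<le>r. ?a i k)" by (rule sum.swap)
  also have "\<dots> = (\<Sum>k\<in>?S. degree E k)" by (simp add: outer)
  finally show ?thesis .
qed

text \<open>If \<open>r\<close> is stuck, then besides the clique \<open>{..r}\<close>, each later
  \<open>k\<close> has degree at least \<open>min (f k) (Suc r)\<close>. By edge counting, the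
  criterion at \<open>Suc r\<close> (indices start at 0) bounds the sum of \<open>f\<close> over
  \<open>{..r}\<close> by the sum of the degrees, although \<open>r\<close> is deficient.\<close>

lemma partial_realization_step:
  assumes E: "partial_realization n f r E" and r: "r < n" and less: "degree E r < f r"
    and anti: "\<And>i j. i \<le> j \<Longrightarrow> j < n \<Longrightarrow> f j \<le> f i"
    and even: "even (\<Sum>i<n. f i)"
    and EG: "(\<Sum>i\<le>r. f i) \<le> Suc r * r + (\<Sum>k\<in>{Suc r..<n}. min (f k) (Suc r))"
  shows "\<exists>E'. partial_realization n f r E' \<and> degree E r < degree E' r"
proof (rule ccontr)
  assume no: "\<not> ?thesis"
  have sg: "simple_graph {..<n} E" and cover: "\<forall>e\<in>E. \<exists>x\<in>e. x \<le> r"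
    and le: "\<And>v. v < n \<Longrightarrow> degree E v \<le> f v" and eq: "\<And>v. v < r \<Longrightarrow> degree E v = f v"
    using E by (auto simp: partial_realization_def)
  note edgeD = simple_graph_edgeD[OF sg]
  \<comment> \<open>In the instances below, the first argument is the set of added edges and the
    second the set of deleted ones.\<close>
  have no_exchange: False
    if "finite I" "D \<subseteq> E" "I \<inter> E = {}"
      "\<forall>e\<in>I. e \<subseteq> {..<n} \<and> card e = 2 \<and> (\<exists>x\<in>e. x \<le> r)"
      "\<forall>v<n. degree E v + degree I v \<le> f v + degree D v"
      "\<forall>v<r. degree I v = degree D v" "degree D r < degree I r" for D I
    using partial_realization_exchange[OF E that(1-6)] no that(7)
      degree_exchange[OF simple_graph_finite[OF sg] that(1-3), of r] by force
  have larger: "degree E r < degree E i" if "i < r" for i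
    using less eq[OF that] anti[of i r] that r by simp
  have adj_deficient: "{r, k} \<in> E" if k: "r < k" "k < n" "degree E k < f k" for k
  proof (rule ccontr)
    assume "{r, k} \<notin> E"
    then show False using k r less le
      by (intro no_exchange[of "{{r, k}}" "{}"]) (auto simp: degree_insert)
  qed
  have adj_r: "{i, r} \<in> E" if i: "i < r" for i
  proof (rule ccontr)
    assume nadj: "{i, r} \<notin> E"
    obtain u where u: "u < n" "u \<noteq> i" "u \<noteq> r" "{u, i} \<in> E" "{u, r} \<notin> E"
      using private_neighbour[OF sg larger[OF i]] by auto
    show False
    \<comment> \<open>Trading \<open>{u, i}\<close> for \<open>{u, r}\<close> and
      \<open>{i, r}\<close> raises \<open>r\<close> by two and fixes the other degrees, so a
      deficiency of one needs separate treatment.\<close>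
    proof (cases "degree E r + 2 \<le> f r")
      case True
      then show False using nadj u i r le
        by (intro no_exchange[of "{{u, r}, {i, r}}" "{{u, i}}"])
          (auto simp: degree_insert doubleton_eq_iff)
    next
      case False
      then have fr: "f r = Suc (degree E r)" using less by simp
      \<comment> \<open>Parity: the degree sum and the sum of \<open>f\<close> are even, so a vertex
        lacking exactly one is not the only deficient one. Vertices below \<open>r\<close> are
        saturated.\<close>
      have "\<exists>k. r < k \<and> k < n \<and> degree E k < f k"
      proof (rule ccontr)
        assume "\<not> ?thesis"
        then have "f v = degree E v" if "v \<in> {..<n} - {r}" for v
          using eq le that by (metis DiffD1 DiffD2 insertI1 lessThan_iff le_neq_implies_less nat_neq_iff)
        then have "(\<Sum>i<n. f i) = Suc (\<Sum>i<n. degree E i)"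
          using r fr by (simp add: sum.remove[of "{..<n}" r])
        then show False using even handshake[OF sg] by simp
      qed
      then obtain k where k: "r < k" "k < n" "degree E k < f k" by blast
      have rk: "{r, k} \<in> E" using adj_deficient k by blast
      have "u \<noteq> k" using u rk by (auto simp: insert_commute)
      \<comment> \<open>Deleting \<open>{r, k}\<close> too reduces the gain at \<open>r\<close> to
        one; \<open>k\<close> may lose degree, as it lies beyond \<open>r\<close>.\<close>
      then show False using nadj u i r le k rk less
        by (intro no_exchange[of "{{u, r}, {i, r}}" "{{r, k}, {u, i}}"])
          (auto simp: degree_insert doubleton_eq_iff)
    qed
  qed
  have outer: "min (f k) (Suc r) \<le> degree E k" if k: "r < k" "k < n" for k
  proof (rule ccontr)
    assume "\<not> ?thesis"
    then have dk: "degree E k < f k" "degree E k < Suc r" by auto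
    have rk: "{r, k} \<in> E" using adj_deficient k dk by blast
    have "\<exists>i\<le>r. {i, k} \<notin> E"
    proof (rule ccontr)
      assume "\<not> ?thesis"
      then have "{..r} \<subseteq> {u \<in> {..<n}. {u, k} \<in> E}" using r by auto
      then have "card {..r} \<le> degree E k"
        unfolding degree_eq_card_neighbours[OF sg] by (intro card_mono) auto
      then show False using dk by simp
    qed
    then obtain i where i: "i < r" "{i, k} \<notin> E" using rk by (metis le_neq_implies_less)
    obtain u where u: "u < n" "u \<noteq> i" "u \<noteq> r" "{u, i} \<in> E" "{u, r} \<notin> E"
      using private_neighbour[OF sg larger[OF i(1)]] by auto
    have "u \<noteq> k" using u rk by (auto simp: insert_commute)
    \<comment> \<open>The exchange raises \<open>r\<close> and \<open>k\<close> by one each, both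
      being deficient, and fixes \<open>u\<close> and \<open>i\<close>.\<close>
    then show False using u i r le k rk less dk
      by (intro no_exchange[of "{{u, r}, {i, k}}" "{{u, i}}"])
        (auto simp: degree_insert doubleton_eq_iff)
  qed
  have inner: "{i, j} \<in> E" if ij: "i < j" "j < r" for i j
  proof (rule ccontr)
    assume nadj: "{i, j} \<notin> E"
    have i: "i < r" using ij by simp
    obtain u where u: "u < n" "u \<noteq> i" "u \<noteq> r" "{u, i} \<in> E" "{u, r} \<notin> E"
      using private_neighbour[OF sg larger[OF i]] by auto
    obtain w where w: "w < n" "w \<noteq> j" "w \<noteq> r" "{w, j} \<in> E" "{w, r} \<notin> E"
      using private_neighbour[OF sg larger[OF ij(2)]] by auto
    \<comment> \<open>The exchange costs \<open>w\<close> one unit, also when \<open>u = w\<close>;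
      this is harmless only beyond \<open>r\<close>.\<close>
    have "r < u" "r < w" using adj_r u w by (meson linorder_neqE_nat)+
    then show False using u w ij r le less nadj
      by (intro no_exchange[of "{{i, j}, {u, r}}" "{{u, i}, {w, j}}"])
        (auto simp: degree_insert doubleton_eq_iff intro: le_SucI)
  qed
  have clique: "{i, j} \<in> E" if "i < j" "j \<le> r" for i j
    using inner[of i j] adj_r[of i] that by (cases "j = r") auto
  have "(\<Sum>i\<le>r. f i) \<le> Suc r * r + (\<Sum>k\<in>{Suc r..<n}. degree E k)"
    by (rule order.trans[OF EG]) (intro add_left_mono sum_mono outer, auto)
  also have "\<dots> = (\<Sum>i\<le>r. degree E i)"
    using clique_degree_sum[OF sg r cover clique] by simp
  also have "\<dots> < (\<Sum>i\<le>r. f i)"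
    using less le r by (intro sum_strict_mono_ex1) auto
  finally show False by simp
qed

text \<open>Saturating \<open>r\<close> turns a partial realization for \<open>r\<close> into one
  for \<open>Suc r\<close>. The outer induction starts from the empty graph; the inner one is on the
  deficiency of \<open>r\<close>.\<close>

theorem Erdos_Gallai_sufficient:
  assumes anti: "\<And>i j. i \<le> j \<Longrightarrow> j < n \<Longrightarrow> f j \<le> f i"
    and even: "even (\<Sum>i<n. f i)"
    and EG: "\<And>k. 0 < k \<Longrightarrow> k \<le> n \<Longrightarrow>
      (\<Sum>i<k. f i) \<le> k * (k - 1) + (\<Sum>i\<in>{k..<n}. min (f i) k)"
  shows "\<exists>E. simple_graph {..<n} E \<and> (\<forall>v<n. degree E v = f v)"
proof -
  have saturate: "\<exists>E'. partial_realization n f r E' \<and> degree E' r = f r"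
    if "partial_realization n f r E" "r < n" for r E
    using that
  proof (induction "f r - degree E r" arbitrary: E rule: less_induct)
    case less
    show ?case
    proof (cases "degree E r < f r")
      case True
      have EGr: "(\<Sum>i\<le>r. f i) \<le> Suc r * r + (\<Sum>k\<in>{Suc r..<n}. min (f k) (Suc r))"
        using EG[of "Suc r"] less.prems by (simp add: lessThan_Suc_atMost)
      obtain E' where E': "partial_realization n f r E'" "degree E r < degree E' r"
        using partial_realization_step[OF less.prems True anti even EGr] by auto
      have "f r - degree E' r < f r - degree E r" using E'(2) True by linarith
      then show ?thesis using E'(1) less.prems(2) by (rule less.hyps)
    next
      case False
      moreover have "degree E r \<le> f r" using less.prems by (simp add: partial_realization_def)
      ultimately show ?thesis using less.prems(1) by (intro exI[of _ E]) simp
    qed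
  qed
  have "\<exists>E. partial_realization n f r E" if "r \<le> n" for r
    using that
  proof (induction r)
    case 0
    have "partial_realization n f 0 {}" by (simp add: partial_realization_def simple_graph_def)
    then show ?case by blast
  next
    case (Suc r)
    then obtain E where "partial_realization n f r E" "degree E r = f r"
      using saturate[of r] by auto
    then have "partial_realization n f (Suc r) E"
      unfolding partial_realization_def by (metis le_SucI less_Suc_eq)
    then show ?case by blast
  qed
  from this[of n] show ?thesis by (auto simp: partial_realization_def)
qed

section \<open>The Erdos-Gallai inequalities from the hypothesis on the region\<close>

text \<open>Here \<open>S\<close> is the sum of the first \<open>k\<close> entries and \<open>T\<close> is the sum of \<open>min d\<^sub>i k\<close> over the others.\<close>

lemma JMS_imp_Erdos_Gallai_arith:
  fixes n \<Sigma> c\<^sub>1 c\<^sub>2 k S T :: int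
  assumes c: "0 \<le> c\<^sub>2" "c\<^sub>1 < n" and k: "c\<^sub>2 < k" "k \<le> c\<^sub>1"
    and \<Sigma>: "n * c\<^sub>2 \<le> \<Sigma>" "\<Sigma> \<le> n * c\<^sub>1"
    and JMS: "(\<Sigma> - n * c\<^sub>2) * (n * c\<^sub>1 - \<Sigma>)
       \<le> (c\<^sub>1 - c\<^sub>2) * ((\<Sigma> - n * c\<^sub>2) * (n - c\<^sub>1 - 1) + (n * c\<^sub>1 - \<Sigma>) * c\<^sub>2)"
    and S: "S \<le> k * c\<^sub>1" "S \<le> \<Sigma> - (n - k) * c\<^sub>2"
    and T: "(n - k) * c\<^sub>2 \<le> T"
      "(c\<^sub>1 - c\<^sub>2) * (n - k) * c\<^sub>2 + (\<Sigma> - S - (n - k) * c\<^sub>2) * (k - c\<^sub>2) \<le> (c\<^sub>1 - c\<^sub>2) * T"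
  shows "S \<le> k * (k - 1) + T"
proof -
  define D where "D = c\<^sub>1 - c\<^sub>2"
  define X where "X = \<Sigma> - n * c\<^sub>2"
  have D: "D > 0" and c1: "c\<^sub>1 = c\<^sub>2 + D" using k by (auto simp: D_def)
  have \<Sigma>_eq: "\<Sigma> = X + n * c\<^sub>2" by (simp add: X_def)
  define Y where "Y = n * D - X"
  have X: "X \<ge> 0" and Y: "Y \<ge> 0"
    using \<Sigma> by (auto simp: X_def Y_def D_def algebra_simps)
  \<comment> \<open>Here \<open>Y\<close> is \<open>n * c\<^sub>1 - \<Sigma>\<close>; as
    \<open>X + Y = n * D\<close>, the terms of \<open>JMS\<close> with factor \<open>X\<close>
    combine into the left side.\<close>
  have J: "X * (D * (1 + c\<^sub>1) - X) \<le> D * (c\<^sub>2 * Y)"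
    using JMS unfolding \<Sigma>_eq Y_def c1 by (simp add: algebra_simps)
  show ?thesis
  proof (cases "k * D \<le> X")
    case True
    \<comment> \<open>This is the claim times \<open>D\<close> for \<open>S = k * c\<^sub>1\<close>
      and the least \<open>D * T\<close> allowed by \<open>T(2)\<close>. If the bracket is
      nonnegative, it follows from \<open>J\<close> by lowering the factor \<open>X\<close> to
      \<open>k * D\<close>.\<close>
    have F: "k * (D * (1 + c\<^sub>1) - X) \<le> c\<^sub>2 * Y"
    proof (cases "D * (1 + c\<^sub>1) - X \<ge> 0")
      case pos: True
      have "(k * D) * (D * (1 + c\<^sub>1) - X) \<le> X * (D * (1 + c\<^sub>1) - X)"
        using True pos by (rule mult_right_mono)
      then have "D * (k * (D * (1 + c\<^sub>1) - X)) \<le> D * (c\<^sub>2 * Y)"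
        using J by (simp add: ac_simps)
      then show ?thesis using D by simp
    next
      case False
      then have "k * (D * (1 + c\<^sub>1) - X) \<le> 0" using k c by (intro mult_nonneg_nonpos) auto
      then show ?thesis using c Y by (smt (verit) mult_nonneg_nonneg)
    qed
    \<comment> \<open>After \<open>T(2)\<close> is inserted, \<open>S\<close> has the positive
      coefficient \<open>D + k - c\<^sub>2\<close>, so \<open>S = k * c\<^sub>1\<close> is the worst
      case.\<close>
    have "S * (D + k - c\<^sub>2) \<le> (k * c\<^sub>1) * (D + k - c\<^sub>2)"
      using S(1) D k by (intro mult_right_mono) auto
    then have "D * S \<le> D * (k * (k - 1) + T)"
      using T(2) F unfolding \<Sigma>_eq Y_def c1 by (simp add: algebra_simps)
    then show ?thesis using D by simp
  next
    case False
    \<comment> \<open>This is the claim for the extreme values \<open>S = X + k * c\<^sub>2\<close>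
      and \<open>T = (n - k) * c\<^sub>2\<close>.\<close>
    have g: "0 \<le> k * (k - 1) + n * c\<^sub>2 - 2 * k * c\<^sub>2 - X"
    proof (cases "D * c\<^sub>2 \<le> X")
      case True
      have "D * (c\<^sub>2 + 1) \<le> D * k" using D k by (intro mult_left_mono) auto
      \<comment> \<open>\<open>D * D\<close> times the goal is a quadratic in \<open>k * D\<close>
        whose value at \<open>X\<close> is the slack of \<open>J\<close>; this product is the
        remainder. Its second factor is the sum of \<open>D * k - D * (c\<^sub>2 + 1)\<close> and
        \<open>X - D * c\<^sub>2\<close>.\<close>
      then have "0 \<le> (k * D - X) * (k * D + X - D * (1 + 2 * c\<^sub>2))"
        using False True by (intro mult_nonneg_nonneg) (auto simp: algebra_simps)
      also have "\<dots> \<le> (k * D - X) * (k * D + X - D * (1 + 2 * c\<^sub>2))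
          + (D * (c\<^sub>2 * Y) - X * (D * (1 + c\<^sub>1) - X))"
        using J by simp
      also have "\<dots> = D * D * (k * (k - 1) + n * c\<^sub>2 - 2 * k * c\<^sub>2 - X)"
        unfolding Y_def c1 by (simp add: algebra_simps)
      finally show ?thesis using D by (auto simp: zero_le_mult_iff mult_le_0_iff)
    next
      case False
      \<comment> \<open>The goal expression is \<open>(k - c\<^sub>2) * (k - c\<^sub>2 - 1) +
        c\<^sub>2 * (n - 1 - c\<^sub>2) - X\<close>, and \<open>X < D * c\<^sub>2\<close>
        here.\<close>
      have "c\<^sub>2 * D \<le> c\<^sub>2 * (n - 1 - c\<^sub>2)" using c c1 by (intro mult_left_mono) auto
      moreover have "0 \<le> (k - c\<^sub>2) * (k - c\<^sub>2 - 1)" using k by (intro mult_nonneg_nonneg) auto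
      ultimately show ?thesis using False by (simp add: algebra_simps)
    qed
    then show ?thesis using S(2) T(1) unfolding \<Sigma>_eq by (simp add: algebra_simps)
  qed
qed

text \<open>The left side is at most \<open>k * c\<^sub>1\<close>. For
  \<open>k \<le> c\<^sub>2\<close> the right side is \<open>k * (n - 1)\<close>, and for
  \<open>k > c\<^sub>1\<close> already \<open>k * (k - 1)\<close> suffices; \<open>JMS\<close>
  serves the range between.\<close>

lemma JMS_imp_Erdos_Gallai:
  fixes f :: "nat \<Rightarrow> nat"
  assumes JMS: "\<phi>_JMS n \<Sigma> c\<^sub>1 c\<^sub>2" and c: "c\<^sub>1 < n"
    and bounds: "\<And>i. i < n \<Longrightarrow> c\<^sub>2 \<le> f i \<and> f i \<le> c\<^sub>1"
    and \<Sigma>: "(\<Sum>i<n. f i) = \<Sigma>" and k: "0 < k" "k \<le> n"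
  shows "(\<Sum>i<k. f i) \<le> k * (k - 1) + (\<Sum>i\<in>{k..<n}. min (f i) k)"
proof -
  have Sk: "(\<Sum>i<k. f i) \<le> k * c\<^sub>1"
    using sum_bounded_above[of "{..<k}" f c\<^sub>1] bounds k by simp
  consider "k \<le> c\<^sub>2" | "c\<^sub>1 < k" | "c\<^sub>2 < k" "k \<le> c\<^sub>1" by linarith
  then show ?thesis
  proof cases
    case 1
    then have "(\<Sum>i\<in>{k..<n}. min (f i) k) = (\<Sum>i\<in>{k..<n}. k)"
      using bounds by (intro sum.cong) (auto simp: min_def intro: order.trans antisym)
    then have "k * (k - 1) + (\<Sum>i\<in>{k..<n}. min (f i) k) = k * (k - 1 + (n - k))"
      by (simp add: algebra_simps)
    moreover have "k * c\<^sub>1 \<le> k * (k - 1 + (n - k))" using c k by (intro mult_le_mono2) auto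
    ultimately show ?thesis using Sk by linarith
  next
    case 2
    then have "k * c\<^sub>1 \<le> k * (k - 1)" by (intro mult_le_mono2) auto
    then show ?thesis using Sk by linarith
  next
    case 3
    let ?D = "int c\<^sub>1 - int c\<^sub>2"
    let ?S = "\<Sum>i<k. int (f i)" and ?R = "\<Sum>i\<in>{k..<n}. int (f i)"
    let ?T = "\<Sum>i\<in>{k..<n}. min (int (f i)) (int k)"
    have split: "?S + ?R = int \<Sigma>"
      using k \<Sigma> sum.atLeastLessThan_concat[of 0 k n "\<lambda>i. int (f i)"]
      by (simp add: lessThan_atLeast0 flip: of_nat_sum)
    have R: "(int n - int k) * int c\<^sub>2 \<le> ?R"
      using sum_bounded_below[of "{k..<n}" "int c\<^sub>2" "\<lambda>i. int (f i)"] bounds k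
      by (simp add: of_nat_diff)
    have T: "(int n - int k) * int c\<^sub>2 \<le> ?T"
      using sum_bounded_below[of "{k..<n}" "int c\<^sub>2" "\<lambda>i. min (int (f i)) (int k)"] bounds k 3
      by (simp add: of_nat_diff)
    \<comment> \<open>By concavity, \<open>min _ k\<close> lies above its chord from value
      \<open>c\<^sub>2\<close> at \<open>c\<^sub>2\<close> to value \<open>k\<close> at
      \<open>c\<^sub>1\<close>; the factor \<open>?D\<close> clears the denominator.\<close>
    have chord: "?D * int c\<^sub>2 + (int (f i) - int c\<^sub>2) * (int k - int c\<^sub>2)
        \<le> ?D * min (int (f i)) (int k)" if "i \<in> {k..<n}" for i
    proof (cases "f i \<le> k")
      case True
      have "(int (f i) - int c\<^sub>2) * (int k - int c\<^sub>2) \<le> (int (f i) - int c\<^sub>2) * ?D"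
        using bounds[of i] that 3 by (intro mult_left_mono) auto
      then show ?thesis using True by (simp add: min_def algebra_simps)
    next
      case False
      have "(int (f i) - int c\<^sub>2) * (int k - int c\<^sub>2) \<le> ?D * (int k - int c\<^sub>2)"
        using bounds[of i] that 3 by (intro mult_right_mono) auto
      then show ?thesis using False by (simp add: min_def algebra_simps)
    qed
    have "?D * (int n - int k) * int c\<^sub>2 + (?R - (int n - int k) * int c\<^sub>2) * (int k - int c\<^sub>2)
        = (\<Sum>i\<in>{k..<n}. ?D * int c\<^sub>2 + (int (f i) - int c\<^sub>2) * (int k - int c\<^sub>2))"
      using k by (simp add: sum.distrib sum_subtractf of_nat_diff algebra_simps
          flip: sum_distrib_right sum_distrib_left)
    also have "\<dots> \<le> (\<Sum>i\<in>{k..<n}. ?D * min (int (f i)) (int k))"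
      using chord by (rule sum_mono)
    finally have T': "?D * (int n - int k) * int c\<^sub>2
        + (int \<Sigma> - ?S - (int n - int k) * int c\<^sub>2) * (int k - int c\<^sub>2) \<le> ?D * ?T"
      by (simp add: sum_distrib_left flip: split)
    have "n * c\<^sub>2 \<le> \<Sigma>" "\<Sigma> \<le> n * c\<^sub>1"
      using sum_bounded_below[of "{..<n}" c\<^sub>2 f] sum_bounded_above[of "{..<n}" f c\<^sub>1] bounds \<Sigma>
      by auto
    then have \<Sigma>_bounds: "int n * int c\<^sub>2 \<le> int \<Sigma>" "int \<Sigma> \<le> int n * int c\<^sub>1"
      by (simp_all flip: of_nat_mult)
    have "?S \<le> int k * (int k - 1) + ?T"
    proof (rule JMS_imp_Erdos_Gallai_arith[OF _ _ _ _ \<Sigma>_bounds _ _ _ T T'])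
      show "?S \<le> int k * int c\<^sub>1" using Sk by (simp flip: of_nat_sum of_nat_mult)
    qed (use c 3 JMS split R in \<open>auto simp: \<phi>_JMS_def\<close>)
    also have "int k * (int k - 1) + ?T = int (k * (k - 1) + (\<Sum>i\<in>{k..<n}. min (f i) k))"
      using k by (simp add: of_nat_diff of_nat_min)
    finally show ?thesis by (simp only: of_nat_sum [symmetric] of_nat_le_iff)
  qed
qed

theorem theorem3p6:
  shows "fully_graphic (region \<phi>_JMS)"
  unfolding fully_graphic_def
proof
  fix d assume "d \<in> region \<phi>_JMS"
  then obtain n \<Sigma> c\<^sub>1 c\<^sub>2 where c: "c\<^sub>1 < n" and JMS: "\<phi>_JMS n \<Sigma> c\<^sub>1 c\<^sub>2"
    and d: "d \<in> degree_seqs n \<Sigma> c\<^sub>1 c\<^sub>2"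
    by (auto simp: region_def)
  have len: "length d = n" and sum: "sum_list d = int \<Sigma>" "even (sum_list d)"
    and sorted: "sorted_wrt (\<ge>) d"
    and range: "\<And>x. x \<in> set d \<Longrightarrow> int c\<^sub>2 \<le> x \<and> x \<le> int c\<^sub>1"
    using d by (auto simp: degree_seqs_def sorted_wrt_append)
  \<comment> \<open>Entries are at least \<open>int c\<^sub>2\<close>, hence nonnegative, so
    \<open>nat\<close> loses nothing below \<open>n\<close>.\<close>
  define f where "f i = nat (d ! i)" for i
  have f: "int (f i) = d ! i" if "i < n" for i
    using range[of "d ! i"] that len by (simp add: f_def)
  have bounds: "c\<^sub>2 \<le> f i \<and> f i \<le> c\<^sub>1" if "i < n" for i
    using range[of "d ! i"] f[OF that] that len by simp
  have anti: "f j \<le> f i" if "i \<le> j" "j < n" for i j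
    using sorted that len f[of i] f[of j]
    by (cases "i = j") (auto simp: sorted_wrt_iff_nth_less f_def intro!: nat_mono)
  have "int (\<Sum>i<n. f i) = int \<Sigma>"
    using sum(1) f len by (simp add: sum_list_sum_nth lessThan_atLeast0)
  then have \<Sigma>: "(\<Sum>i<n. f i) = \<Sigma>" by linarith
  have "\<exists>E. simple_graph {..<n} E \<and> (\<forall>v<n. degree E v = f v)"
    using JMS_imp_Erdos_Gallai[OF JMS c bounds \<Sigma>] anti \<Sigma> sum
    by (intro Erdos_Gallai_sufficient) auto
  then show "graphic d" using len f by (auto simp: graphic_def)
qed

end
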